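(* Let $\Omega$ be an arbitrary non-empty set, $\mathcal{E}\subseteq\mathcal{P}(\Omega)$ an arbitrary non-empty family of events, and $N:\mathcal{E}\to[0,1]$ a necessity assessment (i.e. an arbitrary function). Then the following statements are equivalent: (i) $N$ is coherent-1N; (ii) $N$ is coherent-2N; (iii) $N$ is coherent-3N; (iv) $N$ is coherent-4N; (v) $N$ is coherent-5N.
   Context: $\mathcal{P}(\Omega)$ is the power set of $\Omega$; $\mathbf{1}_A:\Omega\to\{0,1\}$ is the indicator of $A$. For a non-empty family $\mathcal{G}\subseteq\mathcal{P}(\Omega)$, $\mathcal{A}_{\mathcal{G}}$ denotes the minimal algebra of subsets of $\Omega$ containing $\mathcal{G}$, and $\mathcal{U}_{\mathcal{G}}=\mathcal{A}_{\mathcal{G}}\setminus\{\emptyset\}$. For $A\in\mathcal{A}_{\mathcal{G}}$ let $\tilde{A}=\{B\in\mathcal{U}_{\mathcal{G}}:B\subseteq A\}\subseteq\mathcal{U}_{\mathcal{G}}$, and let $\mathfrak{A}_{\mathcal{G}}$ be the minimal algebra of subsets of $\mathcal{U}_{\mathcal{G}}$ containing $\{\tilde{A}:A\in\mathcal{U}_{\mathcal{G}}\}$. For $B\ne\emptyset$ and an event $E$, $\min_{\omega\in B}\mathbf{1}_E(\omega)$ equals $1$ if $B\subseteq E$ and $0$ otherwise. A finitely minitive necessity measure on an algebra $\mathcal{A}$ of subsets of $\Omega$ is a map $\nu:\mathcal{A}\to[0,1]$ with $\nu(\emptyset)=0$, $\nu(\Omega)=1$ and $\nu(A\cap B)=\min\{\nu(A),\nu(B)\}$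 for all $A,B\in\mathcal{A}$. For a finite non-empty set of events $\mathcal{F}$, let $\{C_1,\dots,C_m\}$ be the set of atoms of the finite algebra $\mathcal{A}_{\mathcal{F}}$ (the finest partition of $\Omega$ contained in $\mathcal{A}_{\mathcal{F}}$). $\mathbf{chains}(\mathcal{U}_{\mathcal{F}})$ is the collection of subfamilies $\mathcal{D}_{\mathcal{F}}=\{D_1,\dots,D_m\}$ of $\mathcal{U}_{\mathcal{F}}$ of the form $D_1=C_{i_1}$, $D_2=C_{i_1}\cup C_{i_2}$, $\dots$, $D_m=C_{i_1}\cup\cdots\cup C_{i_m}=\Omega$, for a permutation $(i_1,\dots,i_m)$ of $(1,\dots,m)$. A necessity assessment $N:\mathcal{E}\to[0,1]$ is called: - coherent-1N if there is a finitely minitive necessity measure $N':\mathcal{A}_{\mathcal{E}}\to[0,1]$ with $N(E)=N'(E)$ for every $E\in\mathcal{E}$; - coherent-2N if there is a finitely additive probability $\mu:\mathfrak{A}_{\mathcal{E}}\to[0,1]$ such that the mapping $A\mapsto\mu(\tilde{A})$, $A\in\mathcal{A}_{\mathcal{E}}$, is a finitely minitive necessity measure and, for every $E\in\mathcal{E}$, $N(E)=\int_{\mathcal{U}_{\mathcal{E}}}\big(\min_{\omega\in B}\mathbf{1}_E(\omega)\big)\,\mu(\mathrm{d}B)$ (Stieltjes-type integral with respect to a finitely additive measure); - coherent-3N if, for every $n\in\mathbb{N}$ and every $\mathcal{F}=\{E_1,\dots,E_n\}\subseteq\mathcal{E}$, there exists $\mathcal{D}_{\mathcal{F}}\in\mathbf{chains}(\mathcal{U}_{\mathcal{F}})$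 such that the following linear system in the unknowns $x_D$, $D\in\mathcal{D}_{\mathcal{F}}$, has a solution: $\sum_{D\in\mathcal{D}_{\mathcal{F}}}\big(\min_{\omega\in D}\mathbf{1}_{E_i}(\omega)\big)x_D=N(E_i)$ for $i=1,\dots,n$; $\sum_{D\in\mathcal{D}_{\mathcal{F}}}x_D=1$; $x_D\ge 0$ for every $D\in\mathcal{D}_{\mathcal{F}}$; - coherent-4N if, for every $n\in\mathbb{N}$ and every $\mathcal{F}=\{E_1,\dots,E_n\}\subseteq\mathcal{E}$, there exists $\mathcal{D}_{\mathcal{F}}\in\mathbf{chains}(\mathcal{U}_{\mathcal{F}})$ such that, for every $\lambda_1,\dots,\lambda_n\in\mathbb{R}$, the function $G_{\mathcal{F}}:\mathcal{D}_{\mathcal{F}}\to\mathbb{R}$, $G_{\mathcal{F}}(D)=\sum_{i=1}^n\lambda_i\big(\min_{\omega\in D}\mathbf{1}_{E_i}(\omega)-N(E_i)\big)$, satisfies $\max_{D\in\mathcal{D}_{\mathcal{F}}}G_{\mathcal{F}}(D)\ge 0$; - coherent-5N if, for every $n\in\mathbb{N}$ and every $\mathcal{F}=\{E_1,\dots,E_n\}\subseteq\mathcal{E}$, there exists $\mathcal{D}_{\mathcal{F}}\in\mathbf{chains}(\mathcal{U}_{\mathcal{F}})$ such that there is no assessment $N^*:\mathcal{F}\to[0,1]$ distinct from the restriction of $N$ to $\mathcal{F}$ for which the functions $L^*_{\mathcal{F}},L_{\mathcal{F}}:\mathcal{D}_{\mathcal{F}}\to\mathbb{R}$, $L^*_{\mathcal{F}}(D)=\sum_{i=1}^n\big(\min_{\omega\in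 D}\mathbf{1}_{E_i}(\omega)-N^*(E_i)\big)^2$ and $L_{\mathcal{F}}(D)=\sum_{i=1}^n\big(\min_{\omega\in D}\mathbf{1}_{E_i}(\omega)-N(E_i)\big)^2$, satisfy $L^*_{\mathcal{F}}(D)<L_{\mathcal{F}}(D)$ for every $D\in\mathcal{D}_{\mathcal{F}}$. *)

theory Defs
  imports "HOL-Analysis.Analysis" "HOL-Combinatorics.Multiset_Permutations"
begin

definition gen_algebra :: "'a set \<Rightarrow> 'a set set \<Rightarrow> 'a set set" where
  "gen_algebra \<Omega> \<G> = algebra \<Omega> hull \<G>"

definition nonempty_events :: "'a set \<Rightarrow> 'a set set \<Rightarrow> 'a set set" where
  "nonempty_events \<Omega> \<G> = gen_algebra \<Omega> \<G> - {{}}"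

definition subevents :: "'a set \<Rightarrow> 'a set set \<Rightarrow> 'a set \<Rightarrow> 'a set set" where
  "subevents \<Omega> \<G> A = {B \<in> nonempty_events \<Omega> \<G>. B \<subseteq> A}"

definition subevents_algebra :: "'a set \<Rightarrow> 'a set set \<Rightarrow> 'a set set set" where
  "subevents_algebra \<Omega> \<G> =
     gen_algebra (nonempty_events \<Omega> \<G>) (subevents \<Omega> \<G> ` nonempty_events \<Omega> \<G>)"

definition atoms :: "'a set set \<Rightarrow> 'a set set" where
  "atoms \<A> = {C \<in> \<A>. C \<noteq> {} \<and> (\<forall>B\<in>\<A>. B \<subseteq> C \<longrightarrow> B = {} \<or> B = C)}"

lemma algebra_gen_algebra:
  assumes "\<G> \<subseteq> Pow \<Omega>"
  shows "algebra \<Omega> (gen_algebra \<Omega> \<G>)"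
proof -
  have "\<Inter>{M. algebra \<Omega> M \<and> \<G> \<subseteq> M} \<subseteq> Pow \<Omega>"
    using assms algebra_Pow[of \<Omega>] by (intro Inter_lower) simp
  then show ?thesis
    unfolding gen_algebra_def hull_def algebra_iff_Un by simp
qed

lemma finite_gen_algebra:
  assumes "\<F> \<subseteq> Pow \<Omega>" "finite \<F>"
  shows "finite (gen_algebra \<Omega> \<F>)"
proof -
  define \<phi> where "\<phi> S = {\<omega> \<in> \<Omega>. {E \<in> \<F>. \<omega> \<in> E} \<in> S}" for S
  let ?M = "\<phi> ` Pow (Pow \<F>)"
  have "algebra \<Omega> ?M"
    unfolding algebra_iff_Un
  proof (intro conjI ballI)
    show "?M \<subseteq> Pow \<Omega>" by (auto simp: \<phi>_def)
    show "{} \<in> ?M" by (rule image_eqI[of _ _ "{}"]) (auto simp: \<phi>_def)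
    fix a assume "a \<in> ?M"
    then obtain S where S: "a = \<phi> S" "S \<subseteq> Pow \<F>" by auto
    show "\<Omega> - a \<in> ?M"
      by (rule image_eqI[of _ _ "Pow \<F> - S"]) (auto simp: \<phi>_def S)
    fix b assume "b \<in> ?M"
    then obtain T where T: "b = \<phi> T" "T \<subseteq> Pow \<F>" by auto
    show "a \<union> b \<in> ?M"
      by (rule image_eqI[of _ _ "S \<union> T"]) (use S T in \<open>auto simp: \<phi>_def\<close>)
  qed
  moreover have "\<F> \<subseteq> ?M"
  proof
    fix E assume "E \<in> \<F>"
    then show "E \<in> ?M"
      using assms by (intro image_eqI[of _ _ "{S \<in> Pow \<F>. E \<in> S}"]) (auto simp: \<phi>_def)
  qed
  ultimately have "gen_algebra \<Omega> \<F> \<subseteq> ?M"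
    unfolding gen_algebra_def by (intro hull_minimal)
  then show ?thesis
    using assms(2) by (meson finite_Pow_iff finite_imageI finite_subset)
qed

text \<open>The atoms of a finite algebra are the finest partition of the space by its members.\<close>

lemma atoms_finest_partition:
  assumes "algebra \<Omega> \<A>" "finite \<A>"
  shows "partition_on \<Omega> (atoms \<A>)" "atoms \<A> \<subseteq> \<A>"
    "\<And>P. partition_on \<Omega> P \<Longrightarrow> P \<subseteq> \<A> \<Longrightarrow> refines \<Omega> (atoms \<A>) P"
proof -
  interpret algebra \<Omega> \<A> by fact
  show sub: "atoms \<A> \<subseteq> \<A>" by (auto simp: atoms_def)
  have ex: "\<exists>C\<in>atoms \<A>. \<omega> \<in> C" if "\<omega> \<in> \<Omega>" for \<omega>
  proof
    let ?S = "{A \<in> \<A>. \<omega> \<in> A}"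
    have in_A: "\<Inter>?S \<in> \<A>"
    proof -
      have "\<Inter>T \<in> \<A>" if "finite T" "T \<noteq> {}" "T \<subseteq> \<A>" for T
        using that by (induction T rule: finite_ne_induct) auto
      moreover have "finite ?S" "?S \<noteq> {}" "?S \<subseteq> \<A>"
        using assms(2) \<open>\<omega> \<in> \<Omega>\<close> by auto
      ultimately show ?thesis by blast
    qed
    have "B = {} \<or> B = \<Inter>?S" if B: "B \<in> \<A>" "B \<subseteq> \<Inter>?S" for B
    proof (cases "\<omega> \<in> B")
      case True
      then show ?thesis using B by blast
    next
      case False
      then have "\<Omega> - B \<in> ?S" using B \<open>\<omega> \<in> \<Omega>\<close> by auto
      then show ?thesis using B by blast
    qed
    moreover show "\<omega> \<in> \<Inter>?S" by blast
    ultimately show "\<Inter>?S \<in> atoms \<A>"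
      using in_A by (auto simp: atoms_def)
  qed
  show part: "partition_on \<Omega> (atoms \<A>)"
  proof (rule partition_onI)
    show "\<Union>(atoms \<A>) = \<Omega>" using ex sub space_closed by blast
    show "{} \<notin> atoms \<A>" by (auto simp: atoms_def)
    show "disjnt p q" if pq: "p \<in> atoms \<A>" "q \<in> atoms \<A>" "p \<noteq> q" for p q
    proof -
      have "p \<inter> q \<in> \<A>" using pq sub by blast
      then have "p \<inter> q = {} \<or> p \<inter> q = p" "p \<inter> q = {} \<or> p \<inter> q = q"
        using pq by (auto simp: atoms_def)
      then show ?thesis using \<open>p \<noteq> q\<close> by (auto simp: disjnt_def)
    qed
  qed
  show "refines \<Omega> (atoms \<A>) P" if P: "partition_on \<Omega> P" "P \<subseteq> \<A>" for P
    unfolding refines_def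
  proof (intro conjI ballI part P(1))
    fix C assume C: "C \<in> atoms \<A>"
    then obtain \<omega> where \<omega>: "\<omega> \<in> C" by (auto simp: atoms_def)
    then have "\<omega> \<in> \<Union>P" using C part P(1) by (auto simp: partition_on_def)
    then obtain Y where Y: "Y \<in> P" "\<omega> \<in> Y" by blast
    then have "C \<inter> Y \<in> \<A>" using C sub P(2) by blast
    then have "C \<inter> Y = C" using C \<omega> Y by (auto simp: atoms_def)
    then show "\<exists>Y\<in>P. C \<subseteq> Y" using Y by blast
  qed
qed

text \<open>A permutation of the atoms is a list \<open>cs\<close>; the chain consists of the unions of
  its non-empty initial segments.\<close>

definition event_chains :: "'a set \<Rightarrow> 'a set set \<Rightarrow> 'a set set set" where
  "event_chains \<Omega> \<F> =
     {(\<lambda>k. \<Union>(set (take k cs))) ` {1..length cs} | cs.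
        cs \<in> permutations_of_set (atoms (gen_algebra \<Omega> \<F>))}"

definition finitely_additive_prob :: "'a set \<Rightarrow> 'a set set \<Rightarrow> ('a set \<Rightarrow> real) \<Rightarrow> bool" where
  "finitely_additive_prob X \<A> \<mu> \<longleftrightarrow>
     \<mu> \<in> \<A> \<rightarrow> {0..1} \<and> \<mu> X = 1 \<and> additive \<A> \<mu>"

definition algebra_partitions :: "'a set \<Rightarrow> 'a set set \<Rightarrow> 'a set set set" where
  "algebra_partitions X \<A> = {P. partition_on X P \<and> finite P \<and> P \<subseteq> \<A>}"

text \<open>Stieltjes-type integral of a bounded function with respect to a finitely additive
  measure: the lower and upper integrals, taken over finite partitions into members of the
  algebra, coincide.\<close>

definition has_charge_integral ::
    "'a set \<Rightarrow> 'a set set \<Rightarrow> ('a set \<Rightarrow> real) \<Rightarrow> ('a \<Rightarrow> real) \<Rightarrow> real \<Rightarrow> bool" where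
  "has_charge_integral X \<A> \<mu> f I \<longleftrightarrow>
     bounded (f ` X) \<and>
     (SUP P \<in> algebra_partitions X \<A>. \<Sum>A\<in>P. (INF x\<in>A. f x) * \<mu> A) = I \<and>
     (INF P \<in> algebra_partitions X \<A>. \<Sum>A\<in>P. (SUP x\<in>A. f x) * \<mu> A) = I"

definition min_ind :: "'a set \<Rightarrow> 'a set \<Rightarrow> real" where
  "min_ind E B = (MIN \<omega>\<in>B. indicator E \<omega>)"

lemma min_ind_eq:
  assumes "B \<noteq> {}"
  shows "min_ind E B = (if B \<subseteq> E then 1 else 0)"
proof -
  have "indicator E ` B \<subseteq> {0, 1 :: real}" by (auto simp: indicator_def)
  then have fin: "finite (indicator E ` B :: real set)" by (rule finite_subset) simp
  show ?thesis
  proof (cases "B \<subseteq> E")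
    case True
    then have "indicator E ` B = {1 :: real}"
      using assms by (force simp: indicator_def)
    then show ?thesis using True by (simp add: min_ind_def)
  next
    case False
    then obtain \<omega> where "\<omega> \<in> B" "\<omega> \<notin> E" by blast
    then have "(0 :: real) \<in> indicator E ` B" by (force simp: indicator_def)
    then have "Min (indicator E ` B) = (0 :: real)"
      using fin by (intro Min_eqI) (auto simp: indicator_def)
    then show ?thesis using False by (simp add: min_ind_def)
  qed
qed

definition finitely_minitive_necessity ::
    "'a set \<Rightarrow> 'a set set \<Rightarrow> ('a set \<Rightarrow> real) \<Rightarrow> bool" where
  "finitely_minitive_necessity \<Omega> \<A> \<nu> \<longleftrightarrow>
     \<nu> \<in> \<A> \<rightarrow> {0..1} \<and> \<nu> {} = 0 \<and> \<nu> \<Omega> = 1 \<and>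
     (\<forall>A\<in>\<A>. \<forall>B\<in>\<A>. \<nu> (A \<inter> B) = min (\<nu> A) (\<nu> B))"

definition coherent1 :: "'a set \<Rightarrow> 'a set set \<Rightarrow> ('a set \<Rightarrow> real) \<Rightarrow> bool" where
  "coherent1 \<Omega> \<E> N \<longleftrightarrow>
     (\<exists>N'. finitely_minitive_necessity \<Omega> (gen_algebra \<Omega> \<E>) N' \<and> (\<forall>E\<in>\<E>. N E = N' E))"

definition coherent2 :: "'a set \<Rightarrow> 'a set set \<Rightarrow> ('a set \<Rightarrow> real) \<Rightarrow> bool" where
  "coherent2 \<Omega> \<E> N \<longleftrightarrow>
     (\<exists>\<mu>. finitely_additive_prob (nonempty_events \<Omega> \<E>) (subevents_algebra \<Omega> \<E>) \<mu> \<and>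
          finitely_minitive_necessity \<Omega> (gen_algebra \<Omega> \<E>) (\<lambda>A. \<mu> (subevents \<Omega> \<E> A)) \<and>
          (\<forall>E\<in>\<E>. has_charge_integral (nonempty_events \<Omega> \<E>) (subevents_algebra \<Omega> \<E>) \<mu>
                    (\<lambda>B. min_ind E B) (N E)))"

definition coherent3 :: "'a set \<Rightarrow> 'a set set \<Rightarrow> ('a set \<Rightarrow> real) \<Rightarrow> bool" where
  "coherent3 \<Omega> \<E> N \<longleftrightarrow>
     (\<forall>\<F>. finite \<F> \<and> \<F> \<noteq> {} \<and> \<F> \<subseteq> \<E> \<longrightarrow>
       (\<exists>\<D>\<in>event_chains \<Omega> \<F>. \<exists>x :: 'a set \<Rightarrow> real.
          (\<forall>E\<in>\<F>. (\<Sum>D\<in>\<D>. min_ind E D * x D) = N E) \<and>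
          (\<Sum>D\<in>\<D>. x D) = 1 \<and> (\<forall>D\<in>\<D>. x D \<ge> 0)))"

definition coherent4 :: "'a set \<Rightarrow> 'a set set \<Rightarrow> ('a set \<Rightarrow> real) \<Rightarrow> bool" where
  "coherent4 \<Omega> \<E> N \<longleftrightarrow>
     (\<forall>\<F>. finite \<F> \<and> \<F> \<noteq> {} \<and> \<F> \<subseteq> \<E> \<longrightarrow>
       (\<exists>\<D>\<in>event_chains \<Omega> \<F>. \<forall>c :: 'a set \<Rightarrow> real.
          (MAX D\<in>\<D>. \<Sum>E\<in>\<F>. c E * (min_ind E D - N E)) \<ge> 0))"

definition coherent5 :: "'a set \<Rightarrow> 'a set set \<Rightarrow> ('a set \<Rightarrow> real) \<Rightarrow> bool" where
  "coherent5 \<Omega> \<E> N \<longleftrightarrow>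
     (\<forall>\<F>. finite \<F> \<and> \<F> \<noteq> {} \<and> \<F> \<subseteq> \<E> \<longrightarrow>
       (\<exists>\<D>\<in>event_chains \<Omega> \<F>.
          \<not> (\<exists>N'. N' \<in> \<F> \<rightarrow> {0..1} \<and> (\<exists>E\<in>\<F>. N' E \<noteq> N E) \<and>
               (\<forall>D\<in>\<D>. (\<Sum>E\<in>\<F>. (min_ind E D - N' E)\<^sup>2) < (\<Sum>E\<in>\<F>. (min_ind E D - N E)\<^sup>2)))))"

end

theory Submission
  imports Defs
begin

text \<open>The compactness and separation arguments of the finite case are avoided by passing through an
  order condition. Along a chain \<open>\<D>\<close> the sets \<open>{D \<in> \<D>. D \<subseteq> H}\<close> are nested, so for finitely many
  events one of them is contained in all others. Hence each of the chain conditions 3, 4, 5 says in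
  particular that \<open>N\<close> respects finite intersections, and then
  \<open>A \<mapsto> sup {t. finitely many events of value at least t intersect inside A}\<close> is a minitive extension.
  Conversely, a minitive \<open>\<nu>\<close> is carried by the chain obtained from sorting the atoms \<open>C\<close> by
  \<open>\<nu> (\<Omega> - C)\<close>. For condition 2, each level \<open>t\<close> of \<open>\<nu>\<close> gives the filter \<open>{B. \<nu> B \<ge> t}\<close>; ``eventually
  in this filter, downwards'' is a two-valued charge, and these charges are averaged over \<open>t\<close>.\<close>

section \<open>Generated algebras\<close>

lemma gen_algebra_mono: "\<F> \<subseteq> \<G> \<Longrightarrow> gen_algebra \<Omega> \<F> \<subseteq> gen_algebra \<Omega> \<G>"
  unfolding gen_algebra_def by (rule hull_mono)

lemma gen_algebra_superset: "\<G> \<subseteq> gen_algebra \<Omega> \<G>"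
  unfolding gen_algebra_def by (rule hull_subset)

lemma gen_algebra_least: "algebra \<Omega> M \<Longrightarrow> \<G> \<subseteq> M \<Longrightarrow> gen_algebra \<Omega> \<G> \<subseteq> M"
  unfolding gen_algebra_def by (rule hull_minimal)

section \<open>Chains of events\<close>

lemma event_chains_props:
  assumes "\<Omega> \<noteq> {}" "\<F> \<subseteq> Pow \<Omega>" "finite \<F>" "\<D> \<in> event_chains \<Omega> \<F>"
  shows "finite \<D>" "\<D> \<noteq> {}" "\<And>D. D \<in> \<D> \<Longrightarrow> D \<noteq> {}" "\<And>D. D \<in> \<D> \<Longrightarrow> D \<subseteq> \<Omega>"
    "\<And>D D'. D \<in> \<D> \<Longrightarrow> D' \<in> \<D> \<Longrightarrow> D \<subseteq> D' \<or> D' \<subseteq> D"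
proof -
  obtain cs where cs: "cs \<in> permutations_of_set (atoms (gen_algebra \<Omega> \<F>))"
    and \<D>: "\<D> = (\<lambda>k. \<Union>(set (take k cs))) ` {1..length cs}"
    using assms(4) by (auto simp: event_chains_def)
  have set_cs: "set cs = atoms (gen_algebra \<Omega> \<F>)"
    using cs by (auto simp: permutations_of_set_def)
  have part: "partition_on \<Omega> (set cs)"
    unfolding set_cs
    using atoms_finest_partition(1)[OF algebra_gen_algebra finite_gen_algebra] assms by blast
  then have cs_ne: "cs \<noteq> []" using assms(1) by (auto simp: partition_on_def)
  then show "\<D> \<noteq> {}" by (auto simp: \<D> Suc_le_eq)
  show "finite \<D>" by (simp add: \<D>)
  show "D \<noteq> {}" if "D \<in> \<D>" for D
  proof -
    from that obtain k where "k \<in> {1..length cs}" and D: "D = \<Union>(set (take k cs))"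
      unfolding \<D> by blast
    then have k: "k \<ge> 1" by simp
    have "hd cs \<in> set (take k cs)" using k cs_ne by (cases cs; cases k) auto
    moreover have "hd cs \<noteq> {}" using part hd_in_set[OF cs_ne] by (auto simp: partition_on_def)
    ultimately show ?thesis unfolding D by blast
  qed
  show "D \<subseteq> \<Omega>" if "D \<in> \<D>" for D
  proof -
    obtain k where "D = \<Union>(set (take k cs))" using \<open>D \<in> \<D>\<close> unfolding \<D> by blast
    then have "D \<subseteq> \<Union>(set cs)" using set_take_subset[of k cs] by blast
    then show ?thesis using part by (simp add: partition_on_def)
  qed
  show "D \<subseteq> D' \<or> D' \<subseteq> D" if "D \<in> \<D>" "D' \<in> \<D>" for D D'
  proof -
    from that obtain j k where "D = \<Union>(set (take j cs))" "D' = \<Union>(set (take k cs))"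
      unfolding \<D> by blast
    moreover have "set (take j cs) \<subseteq> set (take k cs) \<or> set (take k cs) \<subseteq> set (take j cs)"
      using set_take_subset_set_take[of j k cs] set_take_subset_set_take[of k j cs] by linarith
    ultimately show ?thesis by (auto dest: Union_mono)
  qed
qed

text \<open>The down-sets \<open>{D \<in> \<D>. D \<subseteq> H}\<close> of a chain are linearly
  ordered by inclusion, so a finite nonempty family has a least one. A finite intersection can
  therefore be replaced by a single event of the family, and conditions that compare only two events
  at a time become strong enough.\<close>

lemma chain_subsets_of_Inter:
  assumes "\<And>D D'. D \<in> \<D> \<Longrightarrow> D' \<in> \<D> \<Longrightarrow> D \<subseteq> D' \<or> D' \<subseteq> D" "finite \<G>" "\<G> \<noteq> {}"
  shows "\<exists>H\<in>\<G>. \<forall>D\<in>\<D>. D \<subseteq> H \<longrightarrow> D \<subseteq> \<Inter>\<G>"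
  using assms(2,3)
proof (induction \<G> rule: finite_ne_induct)
  case (singleton H)
  then show ?case by auto
next
  case (insert H \<G>)
  then obtain H' where H': "H' \<in> \<G>" "\<forall>D\<in>\<D>. D \<subseteq> H' \<longrightarrow> D \<subseteq> \<Inter>\<G>" by blast
  show ?case
  proof (cases "\<forall>D\<in>\<D>. D \<subseteq> H' \<longrightarrow> D \<subseteq> H")
    case True
    then have "\<forall>D\<in>\<D>. D \<subseteq> H' \<longrightarrow> D \<subseteq> \<Inter>(insert H \<G>)" using H'(2) by simp
    then show ?thesis using H'(1) by blast
  next
    case False
    \<comment> \<open>If the old winner \<open>H'\<close> fails, then \<open>H\<close> wins. The
      failure is witnessed by a \<open>D0\<close> inside \<open>H'\<close> but not inside
      \<open>H\<close>, and linearity puts every chain member inside \<open>H\<close> below this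
      \<open>D0\<close>.\<close>
    then obtain D0 where D0: "D0 \<in> \<D>" "D0 \<subseteq> H'" "\<not> D0 \<subseteq> H" by auto
    have "D \<subseteq> \<Inter>(insert H \<G>)" if D: "D \<in> \<D>" "D \<subseteq> H" for D
    proof -
      have "D \<subseteq> D0" using assms(1)[OF D(1) D0(1)] D(2) D0(3) by auto
      then have "D \<subseteq> \<Inter>\<G>" using H'(2) D(1) D0(2) by auto
      then show ?thesis using D(2) by simp
    qed
    then show ?thesis by blast
  qed
qed

section \<open>From the chain conditions to a minitive measure\<close>

text \<open>Monotonicity of \<open>N\<close> in the set of chain members that an event contains. The
  first two clauses are the comparisons with the sure and the impossible event, stated separately
  because \<open>\<Omega>\<close> and \<open>{}\<close> may not belong to
  \<open>\<F>\<close>.\<close>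

definition chain_monotone :: "'a set set \<Rightarrow> 'a set set \<Rightarrow> ('a set \<Rightarrow> real) \<Rightarrow> bool" where
  "chain_monotone \<D> \<F> N \<longleftrightarrow>
     (\<forall>E\<in>\<F>. (\<forall>D\<in>\<D>. D \<subseteq> E) \<longrightarrow> N E = 1) \<and>
     (\<forall>H\<in>\<F>. (\<forall>D\<in>\<D>. \<not> D \<subseteq> H) \<longrightarrow> N H = 0) \<and>
     (\<forall>H\<in>\<F>. \<forall>E\<in>\<F>. (\<forall>D\<in>\<D>. D \<subseteq> H \<longrightarrow> D \<subseteq> E) \<longrightarrow> N H \<le> N E)"

lemma chain_monotoneD:
  assumes "chain_monotone \<D> \<F> N"
  shows "E \<in> \<F> \<Longrightarrow> \<forall>D\<in>\<D>. D \<subseteq> E \<Longrightarrow> N E = 1"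
    and "H \<in> \<F> \<Longrightarrow> \<forall>D\<in>\<D>. \<not> D \<subseteq> H \<Longrightarrow> N H = 0"
    and "H \<in> \<F> \<Longrightarrow> E \<in> \<F> \<Longrightarrow> \<forall>D\<in>\<D>. D \<subseteq> H \<longrightarrow> D \<subseteq> E \<Longrightarrow> N H \<le> N E"
  using assms unfolding chain_monotone_def by blast+

text \<open>Bets on one or two events suffice. A stake of 1 on \<open>H\<close> and -1 on
  \<open>E\<close> has the gain \<open>(min_ind H D - min_ind E D) - (N H - N E)\<close>. If the
  first difference is never positive, a nonnegative gain somewhere forces
  \<open>N H \<le> N E\<close>.\<close>

lemma betting_imp_chain_monotone:
  assumes "finite \<F>" "finite \<D>" "\<D> \<noteq> {}" "\<And>D. D \<in> \<D> \<Longrightarrow> D \<noteq> {}" "N \<in> \<F> \<rightarrow> {0..1}"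
    and max: "\<And>c. (MAX D\<in>\<D>. \<Sum>E\<in>\<F>. c E * (min_ind E D - N E)) \<ge> 0"
  shows "chain_monotone \<D> \<F> N"
proof -
  have ex: "\<exists>D\<in>\<D>. (\<Sum>E\<in>\<F>. c E * (min_ind E D - N E)) \<ge> 0" for c
    using max[of c] assms(2,3) by (simp add: Max_ge_iff)
  have one: "\<exists>D\<in>\<D>. u * (min_ind H D - N H) \<ge> 0" if "H \<in> \<F>" for H u
    using ex[of "\<lambda>E. if E = H then u else 0"] that assms(1)
    by (simp add: if_distrib[of "\<lambda>x. x * _"] cong: if_cong)
  show ?thesis
    unfolding chain_monotone_def
  proof (intro conjI ballI impI)
    fix E assume E: "E \<in> \<F>" "\<forall>D\<in>\<D>. D \<subseteq> E"
    then have "N E \<ge> 1" using one[of E "-1"] by (auto simp: min_ind_eq assms(4))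
    moreover have "N E \<le> 1" using assms(5) E(1) by auto
    ultimately show "N E = 1" by simp
  next
    fix H assume H: "H \<in> \<F>" "\<forall>D\<in>\<D>. \<not> D \<subseteq> H"
    then have "N H \<le> 0" using one[of H 1] by (auto simp: min_ind_eq assms(4))
    moreover have "N H \<ge> 0" using assms(5) H(1) by auto
    ultimately show "N H = 0" by simp
  next
    fix H E assume HE: "H \<in> \<F>" "E \<in> \<F>" "\<forall>D\<in>\<D>. D \<subseteq> H \<longrightarrow> D \<subseteq> E"
    \<comment> \<open>Writing the stakes as a difference of two indicators avoids a case
      distinction: for \<open>H = E\<close> they cancel.\<close>
    obtain D where D: "D \<in> \<D>"
      "(\<Sum>G\<in>\<F>. (indicator {H} G - indicator {E} G) * (min_ind G D - N G)) \<ge> 0"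
      using ex[of "\<lambda>G. indicator {H} G - indicator {E} G"] by blast
    have "(\<Sum>G\<in>\<F>. indicator {K} G * (min_ind G D - N G)) = min_ind K D - N K" if "K \<in> \<F>" for K
      using that assms(1) by (simp add: indicator_def if_distrib[of "\<lambda>x. x * _"] cong: if_cong)
    then have "0 \<le> (min_ind H D - N H) - (min_ind E D - N E)"
      using D(2) HE by (simp add: left_diff_distrib sum_subtractf)
    moreover have "min_ind H D \<le> min_ind E D"
      using HE(3) D(1) assms(4) by (simp add: min_ind_eq)
    ultimately show "N H \<le> N E" by linarith
  qed
qed

text \<open>A violation of any clause can be repaired by changing \<open>N\<close> at one event
  (moving it to 1 or 0) or at two events (pooling them), and the repair lowers the penalty at every
  member of the chain.\<close>

lemma penalty_imp_chain_monotone: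
  assumes "finite \<F>" "\<And>D. D \<in> \<D> \<Longrightarrow> D \<noteq> {}" "N \<in> \<F> \<rightarrow> {0..1}"
    and undom: "\<And>N'. N' \<in> \<F> \<rightarrow> {0..1} \<Longrightarrow> \<exists>E\<in>\<F>. N' E \<noteq> N E \<Longrightarrow>
      \<exists>D\<in>\<D>. (\<Sum>E\<in>\<F>. (min_ind E D - N E)\<^sup>2) \<le> (\<Sum>E\<in>\<F>. (min_ind E D - N' E)\<^sup>2)"
  shows "chain_monotone \<D> \<F> N"
proof -
  have one: "\<exists>D\<in>\<D>. (min_ind H D - N H)\<^sup>2 \<le> (min_ind H D - u)\<^sup>2"
    if H: "H \<in> \<F>" and u: "u \<in> {0..1}" "u \<noteq> N H" for H u
  proof -
    have "(N(H := u)) \<in> \<F> \<rightarrow> {0..1}" "\<exists>E\<in>\<F>. (N(H := u)) E \<noteq> N E" using assms(3) H u by auto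
    then obtain D where "D \<in> \<D>"
      "(\<Sum>E\<in>\<F>. (min_ind E D - N E)\<^sup>2) \<le> (\<Sum>E\<in>\<F>. (min_ind E D - (N(H := u)) E)\<^sup>2)"
      using undom by blast
    then show ?thesis using assms(1) H by (auto simp: sum.remove[of _ H])
  qed
  show ?thesis
    unfolding chain_monotone_def
  proof (intro conjI ballI impI)
    fix E assume E: "E \<in> \<F>" "\<forall>D\<in>\<D>. D \<subseteq> E"
    then show "N E = 1" using one[of E 1] by (fastforce simp: min_ind_eq assms(2))
  next
    fix H assume H: "H \<in> \<F>" "\<forall>D\<in>\<D>. \<not> D \<subseteq> H"
    then show "N H = 0" using one[of H 0] by (fastforce simp: min_ind_eq assms(2))
  next
    fix H E assume HE: "H \<in> \<F>" "E \<in> \<F>" "\<forall>D\<in>\<D>. D \<subseteq> H \<longrightarrow> D \<subseteq> E"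
    show "N H \<le> N E"
    proof (rule ccontr)
      assume "\<not> N H \<le> N E"
      then have lt: "N E < N H" by simp
      \<comment> \<open>Pooling \<open>H\<close> and \<open>E\<close> at their mean, with
        \<open>d = N H - N E > 0\<close>. The two penalty terms together drop by
        \<open>d^2/2\<close> if the two indicators agree at \<open>D\<close>, and by
        \<open>d^2/2 + d\<close> if \<open>D\<close> lies in \<open>E\<close> only. The remaining
        case, \<open>D\<close> in \<open>H\<close> only, is excluded by assumption.\<close>
      define m where "m = (N H + N E) / 2"
      let ?N = "N(H := m, E := m)"
      have ne: "H \<noteq> E" using lt by auto
      have "0 \<le> N E" "N H \<le> 1" using assms(3) HE by auto
      then have "?N \<in> \<F> \<rightarrow> {0..1}" using assms(3) lt by (auto simp: m_def)
      moreover have "\<exists>E\<in>\<F>. ?N E \<noteq> N E" using HE lt by (intro bexI[of _ E]) (auto simp: m_def)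
      ultimately obtain D where D: "D \<in> \<D>"
        "(\<Sum>E\<in>\<F>. (min_ind E D - N E)\<^sup>2) \<le> (\<Sum>E\<in>\<F>. (min_ind E D - ?N E)\<^sup>2)"
        using undom by blast
      have split: "sum f \<F> = f H + (f E + sum f (\<F> - {H} - {E}))" for f :: "'a set \<Rightarrow> real"
        using assms(1) HE ne sum.remove[of \<F> H f] sum.remove[of "\<F> - {H}" E f] by auto
      have "(min_ind H D - N H)\<^sup>2 + (min_ind E D - N E)\<^sup>2 \<le> (min_ind H D - m)\<^sup>2 + (min_ind E D - m)\<^sup>2"
        using D(2) ne unfolding split by simp
      moreover have "(N H - N E)\<^sup>2 > 0" using lt by simp
      ultimately show False
        using HE(3) D(1) lt assms(2)[OF D(1)]
        by (auto simp: min_ind_eq m_def power2_eq_square field_simps split: if_splits)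
    qed
  qed
qed

text \<open>Every property of the extension involves only finitely many events at a time, so a
  separate chain may be used for each finite subfamily; no compatibility between these chains is
  required.\<close>

lemma coherent1_if_chain_monotone:
  assumes "\<Omega> \<noteq> {}" "\<E> \<subseteq> Pow \<Omega>" "N \<in> \<E> \<rightarrow> {0..1}"
    and mono: "\<And>\<F>. finite \<F> \<Longrightarrow> \<F> \<noteq> {} \<Longrightarrow> \<F> \<subseteq> \<E> \<Longrightarrow>
      \<exists>\<D>\<in>event_chains \<Omega> \<F>. chain_monotone \<D> \<F> N"
  shows "coherent1 \<Omega> \<E> N"
proof -
  \<comment> \<open>This bound keeps the extension from exceeding \<open>N\<close> on
    \<open>\<E>\<close>. The chain is taken for \<open>insert E \<G>\<close>, so that it controls
    \<open>E\<close> together with all of \<open>\<G>\<close>. The intersection with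
    \<open>\<Omega>\<close> gives an empty \<open>\<G>\<close> the meaning of the sure
    event.\<close>
  have le: "t \<le> N E"
    if \<G>: "finite \<G>" "\<G> \<subseteq> \<E>" "\<forall>H\<in>\<G>. t \<le> N H" and E: "E \<in> \<E>" "\<Omega> \<inter> \<Inter>\<G> \<subseteq> E" and t: "t \<le> 1"
    for \<G> E t
  proof -
    obtain \<D> where \<D>: "\<D> \<in> event_chains \<Omega> (insert E \<G>)" and q: "chain_monotone \<D> (insert E \<G>) N"
      using mono[of "insert E \<G>"] \<G> E by auto
    have "insert E \<G> \<subseteq> Pow \<Omega>" "finite (insert E \<G>)" using \<G> E assms(2) by auto
    note ch = event_chains_props[OF assms(1) this \<D>]
    show ?thesis
    proof (cases "\<G> = {}")
      case True
      then have "\<forall>D\<in>\<D>. D \<subseteq> E" using E(2) ch(4) by auto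
      then have "N E = 1" by (rule chain_monotoneD(1)[OF q insertI1])
      then show ?thesis using t by simp
    next
      case False
      obtain H where H: "H \<in> \<G>" "\<forall>D\<in>\<D>. D \<subseteq> H \<longrightarrow> D \<subseteq> \<Inter>\<G>"
        using chain_subsets_of_Inter[OF ch(5) \<G>(1) False] by blast
      have "\<forall>D\<in>\<D>. D \<subseteq> H \<longrightarrow> D \<subseteq> E"
      proof (intro ballI impI)
        fix D assume D: "D \<in> \<D>" "D \<subseteq> H"
        have "D \<subseteq> \<Omega> \<inter> \<Inter>\<G>" using ch(4)[OF D(1)] H(2)[rule_format, OF D] by (rule Int_greatest)
        then show "D \<subseteq> E" using E(2) by (rule subset_trans)
      qed
      then have "N H \<le> N E" by (rule chain_monotoneD(3)[OF q insertI2[OF H(1)] insertI1])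
      then show ?thesis using bspec[OF \<G>(3) H(1)] by linarith
    qed
  qed
  \<comment> \<open>The analogue of \<open>le\<close> for the impossible event, which may lie
    outside \<open>\<E>\<close>; it yields \<open>N' {} = 0\<close>.\<close>
  have le0: "t \<le> 0"
    if \<G>: "finite \<G>" "\<G> \<subseteq> \<E>" "\<forall>H\<in>\<G>. t \<le> N H" "\<Omega> \<inter> \<Inter>\<G> = {}" for \<G> t
  proof -
    have ne: "\<G> \<noteq> {}" using \<G>(4) assms(1) by auto
    obtain \<D> where \<D>: "\<D> \<in> event_chains \<Omega> \<G>" and q: "chain_monotone \<D> \<G> N"
      using mono[of \<G>] \<G> ne by auto
    have "\<G> \<subseteq> Pow \<Omega>" using \<G> assms(2) by auto
    note ch = event_chains_props[OF assms(1) this \<G>(1) \<D>]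
    obtain H where H: "H \<in> \<G>" "\<forall>D\<in>\<D>. D \<subseteq> H \<longrightarrow> D \<subseteq> \<Inter>\<G>"
      using chain_subsets_of_Inter[OF ch(5) \<G>(1) ne] by blast
    have "\<forall>D\<in>\<D>. \<not> D \<subseteq> H"
    proof (intro ballI notI)
      fix D assume D: "D \<in> \<D>" "D \<subseteq> H"
      have "D \<subseteq> \<Omega> \<inter> \<Inter>\<G>" using ch(4)[OF D(1)] H(2)[rule_format, OF D] by (rule Int_greatest)
      then show False using \<G>(4) ch(3)[OF D(1)] by simp
    qed
    then have "N H = 0" by (rule chain_monotoneD(2)[OF q H(1)])
    then show ?thesis using bspec[OF \<G>(3) H(1)] by linarith
  qed
  \<comment> \<open>\<open>T A\<close> holds the levels \<open>t\<close> at which \<open>A\<close>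
    contains a finite intersection of events of value at least \<open>t\<close>. Level 0 is added by
    hand, since \<open>A\<close> may contain no such intersection and the supremum must be over a
    nonempty set.\<close>
  define T where "T A = {t \<in> {0..1}. t = 0 \<or>
    (\<exists>\<G>. finite \<G> \<and> \<G> \<subseteq> \<E> \<and> (\<forall>H\<in>\<G>. t \<le> N H) \<and> \<Omega> \<inter> \<Inter>\<G> \<subseteq> A)}" for A
  define N' where "N' A = Sup (T A)" for A
  have T01: "0 \<in> T A" "T A \<subseteq> {0..1}" for A by (auto simp: T_def)
  have bdd: "bdd_above (T A)" for A using T01(2)[of A] by (meson bdd_above_Icc bdd_above_mono)
  have T_down: "s \<in> T A" if "t \<in> T A" "0 \<le> s" "s \<le> t" for s t A
  proof (cases "s = 0")
    case False
    then have "t \<noteq> 0" using that by auto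
    with that(1) obtain \<G> where \<G>: "finite \<G>" "\<G> \<subseteq> \<E>" "\<forall>H\<in>\<G>. t \<le> N H" "\<Omega> \<inter> \<Inter>\<G> \<subseteq> A" "t \<le> 1"
      unfolding T_def by auto
    have "\<forall>H\<in>\<G>. s \<le> N H" using \<G>(3) that(3) by force
    then show ?thesis using \<G> that(2,3) unfolding T_def by auto
  qed (simp add: T01)
  have T_mono: "T A \<subseteq> T B" if "A \<subseteq> B" for A B
    using that unfolding T_def by (blast dest: subset_trans)
  have T_Int: "T (A \<inter> B) = T A \<inter> T B" for A B
  proof
    show "T (A \<inter> B) \<subseteq> T A \<inter> T B" using T_mono[of "A \<inter> B"] by blast
    show "T A \<inter> T B \<subseteq> T (A \<inter> B)"
    proof
      fix t assume t: "t \<in> T A \<inter> T B"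
      show "t \<in> T (A \<inter> B)"
      proof (cases "t = 0")
        case False
        then obtain \<G> \<H> where "finite \<G>" "\<G> \<subseteq> \<E>" "\<forall>H\<in>\<G>. t \<le> N H" "\<Omega> \<inter> \<Inter>\<G> \<subseteq> A"
          "finite \<H>" "\<H> \<subseteq> \<E>" "\<forall>H\<in>\<H>. t \<le> N H" "\<Omega> \<inter> \<Inter>\<H> \<subseteq> B"
          using t unfolding T_def by auto
        then have "finite (\<G> \<union> \<H>) \<and> \<G> \<union> \<H> \<subseteq> \<E> \<and> (\<forall>H\<in>\<G> \<union> \<H>. t \<le> N H) \<and> \<Omega> \<inter> \<Inter>(\<G> \<union> \<H>) \<subseteq> A \<inter> B"
          by auto
        moreover have "t \<in> {0..1}" using t T01(2) by blast
        ultimately show ?thesis unfolding T_def by blast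
      qed (simp add: T01)
    qed
  qed
  have N'_mono: "N' A \<le> N' B" if "T A \<subseteq> T B" for A B
    unfolding N'_def using that T01(1)[of A] bdd by (intro cSup_subset_mono) auto
  have N'_Int: "N' (A \<inter> B) = min (N' A) (N' B)" for A B
  proof -
    \<comment> \<open>Each \<open>T A\<close> is downward closed in \<open>{0..1}\<close> and
      contains 0, so any two of them are comparable. This is what turns the supremum of an
      intersection into a minimum of suprema.\<close>
    have "T A \<subseteq> T B \<or> T B \<subseteq> T A"
    proof (rule ccontr)
      assume "\<not> ?thesis"
      then obtain s t where "s \<in> T A" "s \<notin> T B" "t \<in> T B" "t \<notin> T A" by blast
      then show False using T_down T01(2) by (meson atLeastAtMost_iff linear subsetD)
    qed
    then show ?thesis
    proof
      assume "T A \<subseteq> T B"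
      then have "T (A \<inter> B) = T A" using T_Int by blast
      then show ?thesis using N'_mono[OF \<open>T A \<subseteq> T B\<close>] by (simp add: N'_def)
    next
      assume "T B \<subseteq> T A"
      then have "T (A \<inter> B) = T B" using T_Int by blast
      then show ?thesis using N'_mono[OF \<open>T B \<subseteq> T A\<close>] by (simp add: N'_def)
    qed
  qed
  have "1 \<in> T \<Omega>" unfolding T_def by (auto intro!: exI[of _ "{}"])
  then have "N' \<Omega> = 1" unfolding N'_def using T01(2)[of \<Omega>] by (intro cSup_eq_maximum) auto
  moreover have "N' {} = 0"
    unfolding N'_def
  proof (rule cSup_eq_maximum)
    show "t \<le> 0" if "t \<in> T {}" for t using that le0 unfolding T_def by blast
  qed (rule T01)
  moreover have "N' A \<in> {0..1}" for A
    unfolding N'_def using cSup_upper[OF T01(1)[of A] bdd] cSup_least[of "T A" 1] T01[of A] by fastforce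
  moreover have "N E = N' E" if E: "E \<in> \<E>" for E
  proof -
    have "N E \<in> T E" using E assms(3) unfolding T_def by (auto intro!: exI[of _ "{E}"])
    moreover have "t \<le> N E" if "t \<in> T E" for t
    proof (cases "t = 0")
      case True
      then show ?thesis using E assms(3) by auto
    next
      case False
      then show ?thesis using that le[OF _ _ _ E] unfolding T_def by auto
    qed
    ultimately show ?thesis unfolding N'_def by (intro cSup_eq_maximum[symmetric]) auto
  qed
  ultimately show ?thesis
    unfolding coherent1_def finitely_minitive_necessity_def using N'_Int
    by (intro exI[of _ N']) auto
qed

section \<open>From a minitive measure to the chain conditions\<close>

lemma finitely_minitive_necessity_mono:
  assumes "finitely_minitive_necessity \<Omega> \<A> \<nu>" "A \<in> \<A>" "B \<in> \<A>" "A \<subseteq> B"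
  shows "\<nu> A \<le> \<nu> B"
proof -
  have "\<nu> (A \<inter> B) = min (\<nu> A) (\<nu> B)"
    using assms by (auto simp: finitely_minitive_necessity_def)
  moreover have "A \<inter> B = A" using assms(4) by blast
  ultimately show ?thesis by simp
qed

text \<open>The weights are the increments of \<open>\<nu>\<close> along a chain, so the sum for
  \<open>E\<close> telescopes to \<open>\<nu>\<close> of the largest chain member inside
  \<open>E\<close>. The ordering of the atoms is chosen so that this value is already
  \<open>\<nu> E\<close>.\<close>

lemma coherent1_imp_coherent3:
  assumes "\<Omega> \<noteq> {}" "\<E> \<subseteq> Pow \<Omega>" "coherent1 \<Omega> \<E> N"
  shows "coherent3 \<Omega> \<E> N"
  unfolding coherent3_def
proof (intro allI impI)
  fix \<F> assume "finite \<F> \<and> \<F> \<noteq> {} \<and> \<F> \<subseteq> \<E>"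
  then have \<F>: "finite \<F>" "\<F> \<subseteq> \<E>" "\<F> \<subseteq> Pow \<Omega>" using assms(2) by auto
  obtain \<nu> where \<nu>: "finitely_minitive_necessity \<Omega> (gen_algebra \<Omega> \<E>) \<nu>" "\<forall>E\<in>\<E>. N E = \<nu> E"
    using assms(3) by (auto simp: coherent1_def)
  have \<nu>0: "\<nu> {} = 0" and \<nu>1: "\<nu> \<Omega> = 1"
    and \<nu>_Int: "\<And>A B. A \<in> gen_algebra \<Omega> \<E> \<Longrightarrow> B \<in> gen_algebra \<Omega> \<E> \<Longrightarrow> \<nu> (A \<inter> B) = min (\<nu> A) (\<nu> B)"
    using \<nu>(1) by (auto simp: finitely_minitive_necessity_def)
  let ?A = "gen_algebra \<Omega> \<F>"
  interpret algebra \<Omega> ?A by (rule algebra_gen_algebra[OF \<F>(3)])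
  have AE: "A \<in> gen_algebra \<Omega> \<E>" if "A \<in> ?A" for A using that gen_algebra_mono[OF \<F>(2)] by blast
  note fin = finite_gen_algebra[OF \<F>(3,1)]
  note part = atoms_finest_partition(1)[OF algebra_gen_algebra[OF \<F>(3)] fin]
  have "finite (atoms ?A)" using fin atoms_finest_partition(2)[OF algebra_gen_algebra[OF \<F>(3)] fin]
    by (rule rev_finite_subset)
  then obtain cs0 where cs0: "set cs0 = atoms ?A" "distinct cs0" using finite_distinct_list by blast
  \<comment> \<open>An event that misses an atom \<open>C\<close> has necessity at most
    \<open>\<nu> (\<Omega> - C)\<close>. Increasing order puts the tightest of these bounds
    first.\<close>
  define cs where "cs = sort_key (\<lambda>C. \<nu> (\<Omega> - C)) cs0"
  have cs: "set cs = atoms ?A" "distinct cs" "sorted (map (\<lambda>C. \<nu> (\<Omega> - C)) cs)"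
    using cs0 by (simp_all add: cs_def)
  define m where "m = length cs"
  define D where "D k = \<Union>(set (take k cs))" for k
  have D0: "D 0 = {}" by (simp add: D_def)
  have Dm: "D m = \<Omega>" using part cs(1) by (simp add: D_def m_def partition_on_def)
  have D_Suc: "D (Suc k) = D k \<union> cs ! k" if "k < m" for k
    using that by (auto simp: D_def m_def take_Suc_conv_app_nth)
  have cs_at: "cs ! k \<in> atoms ?A" if "k < m" for k
    unfolding cs(1)[symmetric] using that unfolding m_def by (rule nth_mem)
  have cs_ne: "cs ! k \<noteq> {}" and cs_A: "cs ! k \<in> ?A"
    and cs_min: "B \<in> ?A \<Longrightarrow> B \<subseteq> cs ! k \<Longrightarrow> B = {} \<or> B = cs ! k" if "k < m" for k B
  proof -
    have at: "cs ! k \<in> ?A \<and> cs ! k \<noteq> {} \<and> (\<forall>B\<in>?A. B \<subseteq> cs ! k \<longrightarrow> B = {} \<or> B = cs ! k)"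
      using cs_at[OF that] unfolding atoms_def by (rule CollectD)
    show "cs ! k \<noteq> {}" using at by (elim conjE)
    show "cs ! k \<in> ?A" using at by (elim conjE)
    show "B = {} \<or> B = cs ! k" if "B \<in> ?A" "B \<subseteq> cs ! k" 
      by (rule at[THEN conjunct2, THEN conjunct2, rule_format, OF that])
  qed
  have D_disj: "D k \<inter> cs ! k = {}" if "k < m" for k
  proof -
    have "cs ! k \<inter> C = {}" if C: "C \<in> set (take k cs)" for C
    proof -
      obtain j where j: "j < k" "C = cs ! j" using C by (auto simp: in_set_conv_nth)
      then have "cs ! k \<noteq> C" using \<open>k < m\<close> cs(2) by (auto simp: m_def nth_eq_iff_index_eq)
      moreover have "C \<in> atoms ?A" using cs_at j \<open>k < m\<close> by auto
      ultimately show ?thesis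
        using part cs_at[OF \<open>k < m\<close>] by (auto simp: partition_on_def disjoint_def)
    qed
    then show ?thesis by (auto simp: D_def)
  qed
  have D_A: "D k \<in> ?A" if "k \<le> m" for k
    using that by (induction k) (auto simp: D0 D_Suc cs_A)
  have D_mono: "D j \<subseteq> D k" if "j \<le> k" for j k
    unfolding D_def by (rule Union_mono[OF set_take_subset_set_take[OF that]])
  have D_strict: "D j \<noteq> D k" if "j < k" "k \<le> m" for j k
  proof -
    have "cs ! j \<subseteq> D k" using D_mono[of "Suc j" k] D_Suc[of j] that by auto
    then show ?thesis using D_disj[of j] cs_ne[of j] that by auto
  qed
  have inj: "inj_on D {1..m}"
    by (rule linorder_inj_onI) (use D_strict in auto)
  \<comment> \<open>\<open>D k\<close> is the intersection of the complements of the atoms from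
    index \<open>k\<close> on. By minitivity its necessity is the minimum over those complements,
    attained at index \<open>k\<close> because of the sorting. The induction runs downwards from
    \<open>D m = \<Omega>\<close>.\<close>
  have \<nu>_D: "\<nu> (D k) = \<nu> (\<Omega> - cs ! k)" if "k < m" for k
    using that
  proof (induction "m - k" arbitrary: k)
    case (Suc i)
    have "D k = D (Suc k) \<inter> (\<Omega> - cs ! k)"
      using D_Suc[OF Suc.prems] D_disj[OF Suc.prems] D_A[of k] Suc.prems sets_into_space by auto
    then have eq: "\<nu> (D k) = min (\<nu> (D (Suc k))) (\<nu> (\<Omega> - cs ! k))"
      using \<nu>_Int[of "D (Suc k)" "\<Omega> - cs ! k"] AE D_A[of "Suc k"] cs_A[of k] Suc.prems by auto
    have "\<nu> (\<Omega> - cs ! k) \<le> \<nu> (D (Suc k))"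
    proof (cases "Suc k = m")
      case True
      have "\<Omega> - cs ! k \<in> ?A" using cs_A[OF Suc.prems] by auto
      then show ?thesis unfolding True Dm
        using finitely_minitive_necessity_mono[OF \<nu>(1), of "\<Omega> - cs ! k" \<Omega>] AE by auto
    next
      case False
      then have "\<nu> (D (Suc k)) = \<nu> (\<Omega> - cs ! Suc k)" using Suc by auto
      moreover have "\<nu> (\<Omega> - cs ! k) \<le> \<nu> (\<Omega> - cs ! Suc k)"
        using cs(3) Suc.prems False by (auto simp: sorted_iff_nth_Suc m_def)
      ultimately show ?thesis by simp
    qed
    then show ?case using eq by simp
  qed simp
  \<comment> \<open>The unknowns are indexed by sets, so the position of \<open>S\<close> in the
    chain is recovered through the inverse of \<open>D\<close>. The first increment starts from
    \<open>D 0 = {}\<close>, which is not itself a chain member.\<close>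
  define x where "x S = \<nu> S - \<nu> (D (the_inv_into {1..m} D S - 1))" for S
  have xD: "x (D k) = \<nu> (D k) - \<nu> (D (k - 1))" if "k \<in> {1..m}" for k
    using that inj by (simp add: x_def the_inv_into_f_f)
  have tele: "(\<Sum>k=1..n. x (D k)) = \<nu> (D n)" if "n \<le> m" for n
    using that by (induction n) (auto simp: D0 \<nu>0 xD)
  show "\<exists>\<D>\<in>event_chains \<Omega> \<F>. \<exists>x. (\<forall>E\<in>\<F>. (\<Sum>S\<in>\<D>. min_ind E S * x S) = N E) \<and>
      (\<Sum>S\<in>\<D>. x S) = 1 \<and> (\<forall>S\<in>\<D>. 0 \<le> x S)"
  proof (rule bexI[of _ "D ` {1..m}"], rule exI[of _ x], intro conjI ballI)
    show "D ` {1..m} \<in> event_chains \<Omega> \<F>"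
      using cs unfolding event_chains_def D_def m_def permutations_of_set_def by blast
    show "(\<Sum>S\<in>D ` {1..m}. x S) = 1"
      using tele[of m] unfolding sum.reindex[OF inj] by (simp add: Dm \<nu>1)
    show "0 \<le> x S" if "S \<in> D ` {1..m}" for S
    proof -
      from that obtain k where k: "k \<in> {1..m}" "S = D k" by auto
      then have "D (k - 1) \<in> ?A" "D k \<in> ?A" by (auto intro!: D_A)
      then have "\<nu> (D (k - 1)) \<le> \<nu> (D k)"
        by (intro finitely_minitive_necessity_mono[OF \<nu>(1)] AE D_mono) auto
      then show ?thesis using k by (simp add: xD)
    qed
    show "(\<Sum>S\<in>D ` {1..m}. min_ind E S * x S) = N E" if E: "E \<in> \<F>" for E
    proof -
      have EA: "E \<in> ?A" using E gen_algebra_superset by blast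
      define k where "k = Max {k \<in> {0..m}. D k \<subseteq> E}"
      have "k \<in> {k \<in> {0..m}. D k \<subseteq> E}"
        unfolding k_def by (rule Max_in) (auto simp: D0 intro!: exI[of _ 0])
      then have k: "k \<le> m" "D k \<subseteq> E" by auto
      have k_max: "j \<le> k" if "j \<le> m" "D j \<subseteq> E" for j
        unfolding k_def using that by (intro Max_ge) auto
      have D_ne: "D j \<noteq> {}" if "j \<in> {1..m}" for j
        using D_strict[of 0 j] that by (auto simp: D0)
      have iff: "D j \<subseteq> E \<longleftrightarrow> j \<le> k" if "j \<in> {1..m}" for j
        using k_max[of j] k(2) D_mono[of j k] that by auto
      have "(\<Sum>S\<in>D ` {1..m}. min_ind E S * x S) = (\<Sum>j\<in>{1..m}. if j \<le> k then x (D j) else 0)"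
        unfolding sum.reindex[OF inj] by (intro sum.cong) (auto simp: min_ind_eq D_ne iff)
      also have "\<dots> = (\<Sum>j\<in>{j \<in> {1..m}. j \<le> k}. x (D j))"
        by (rule sum.inter_filter[symmetric]) simp
      also have "{j \<in> {1..m}. j \<le> k} = {1..k}" using k(1) by auto
      also have "(\<Sum>j\<in>{1..k}. x (D j)) = \<nu> (D k)" by (rule tele[OF k(1)])
      also have "\<dots> = \<nu> E"
      proof (cases "k = m")
        case True
        then have "E = \<Omega>" using k(2) Dm sets_into_space[OF EA] by simp
        then show ?thesis using True Dm by simp
      next
        case False
        then have km: "k < m" using k by simp
        \<comment> \<open>By maximality of \<open>k\<close>, the atom \<open>cs ! k\<close> is not
          inside \<open>E\<close>, hence it is disjoint from \<open>E\<close>. So \<open>E\<close>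
          lies in the complement of this atom, whose necessity is exactly
          \<open>\<nu> (D k)\<close>.\<close>
        have "\<not> cs ! k \<subseteq> E" using k_max[of "Suc k"] D_Suc[OF km] k(2) km by auto
        moreover have "cs ! k \<inter> E \<in> ?A" using cs_A[OF km] EA by auto
        ultimately have "cs ! k \<inter> E = {}" using cs_min[OF km, of "cs ! k \<inter> E"] by blast
        then have "E \<subseteq> \<Omega> - cs ! k" using EA sets_into_space by blast
        moreover have "\<Omega> - cs ! k \<in> ?A" using cs_A[OF km] by auto
        ultimately have "\<nu> E \<le> \<nu> (D k)"
          unfolding \<nu>_D[OF km] using EA by (intro finitely_minitive_necessity_mono[OF \<nu>(1)] AE)
        moreover have "\<nu> (D k) \<le> \<nu> E"
          using EA k by (intro finitely_minitive_necessity_mono[OF \<nu>(1)] AE D_A)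
        ultimately show ?thesis by simp
      qed
      also have "\<nu> E = N E" using \<nu>(2) E \<F>(2) by auto
      finally show ?thesis .
    qed
  qed
qed

section \<open>From weights on a chain to bets and penalties\<close>

lemma weighted_average_ge_0:
  fixes x g :: "'b \<Rightarrow> real"
  assumes "\<forall>D\<in>\<D>. x D \<ge> 0" "(\<Sum>D\<in>\<D>. x D) = 1" "(\<Sum>D\<in>\<D>. x D * g D) \<ge> 0"
  shows "\<exists>D\<in>\<D>. g D \<ge> 0"
proof (rule ccontr)
  assume "\<not> ?thesis"
  then have neg: "\<forall>D\<in>\<D>. g D < 0" by auto
  have fin: "finite \<D>" using assms(2) by (rule_tac ccontr) simp
  obtain D where D: "D \<in> \<D>" "x D \<noteq> 0" using assms(2) by (metis sum.neutral zero_neq_one)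
  have "(\<Sum>D\<in>\<D>. x D * g D) < (\<Sum>D\<in>\<D>. 0)"
    using fin assms(1) neg D
    by (intro sum_strict_mono_ex1) (force intro!: bexI[of _ D] simp: mult_less_0_iff mult_le_0_iff)+
  then show False using assms(3) by simp
qed

text \<open>A solution of the linear system makes \<open>N E\<close> the average of
  \<open>min_ind E\<close> over the chain, and averaging commutes with affine expressions. Gains and
  penalty differences are both of this form.\<close>

lemma chain_solution_average:
  assumes "finite \<D>" "finite \<F>"
    and "\<forall>E\<in>\<F>. (\<Sum>D\<in>\<D>. min_ind E D * x D) = N E" "(\<Sum>D\<in>\<D>. x D) = 1"
  shows "(\<Sum>D\<in>\<D>. x D * (\<Sum>E\<in>\<F>. c E * min_ind E D + d E)) = (\<Sum>E\<in>\<F>. c E * N E + d E)"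
proof -
  have "(\<Sum>D\<in>\<D>. x D * (\<Sum>E\<in>\<F>. c E * min_ind E D + d E)) =
      (\<Sum>D\<in>\<D>. \<Sum>E\<in>\<F>. c E * (min_ind E D * x D) + x D * d E)"
    by (simp add: sum_distrib_left algebra_simps)
  also have "\<dots> = (\<Sum>E\<in>\<F>. \<Sum>D\<in>\<D>. c E * (min_ind E D * x D) + x D * d E)"
    by (rule sum.swap)
  also have "\<dots> = (\<Sum>E\<in>\<F>. c E * N E + d E)"
  proof (rule sum.cong[OF refl])
    fix E assume "E \<in> \<F>"
    then show "(\<Sum>D\<in>\<D>. c E * (min_ind E D * x D) + x D * d E) = c E * N E + d E"
      using assms(3,4) by (simp add: sum.distrib flip: sum_distrib_left sum_distrib_right)
  qed
  finally show ?thesis .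
qed

lemma chain_solution_imp_betting:
  assumes "finite \<D>" "\<D> \<noteq> {}" "finite \<F>"
    and "\<forall>E\<in>\<F>. (\<Sum>D\<in>\<D>. min_ind E D * x D) = N E" "(\<Sum>D\<in>\<D>. x D) = 1" "\<forall>D\<in>\<D>. x D \<ge> 0"
  shows "(MAX D\<in>\<D>. \<Sum>E\<in>\<F>. c E * (min_ind E D - N E)) \<ge> 0"
proof -
  have "(\<Sum>D\<in>\<D>. x D * (\<Sum>E\<in>\<F>. c E * (min_ind E D - N E))) = 0"
    using chain_solution_average[OF assms(1,3,4,5), of c "\<lambda>E. - c E * N E"]
    by (simp add: right_diff_distrib)
  then have "\<exists>D\<in>\<D>. (\<Sum>E\<in>\<F>. c E * (min_ind E D - N E)) \<ge> 0"
    using weighted_average_ge_0[OF assms(6,5)] by simp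
  then show ?thesis using assms(1,2) by (simp add: Max_ge_iff)
qed

text \<open>In the difference of two quadratic penalties the squares of the indicators cancel, so it
  is affine in them. Its average is the squared distance between \<open>N\<close> and
  \<open>N'\<close>, so it cannot be negative at every member of the chain.\<close>

lemma chain_solution_imp_penalty:
  assumes "finite \<D>" "finite \<F>"
    and "\<forall>E\<in>\<F>. (\<Sum>D\<in>\<D>. min_ind E D * x D) = N E" "(\<Sum>D\<in>\<D>. x D) = 1" "\<forall>D\<in>\<D>. x D \<ge> 0"
  shows "\<exists>D\<in>\<D>. (\<Sum>E\<in>\<F>. (min_ind E D - N E)\<^sup>2) \<le> (\<Sum>E\<in>\<F>. (min_ind E D - N' E)\<^sup>2)"
proof -
  have sq: "(v - b)\<^sup>2 - (v - a)\<^sup>2 = 2 * (a - b) * v + (b\<^sup>2 - a\<^sup>2)" for v a b :: real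
    by (simp add: power2_eq_square algebra_simps)
  have "(\<Sum>D\<in>\<D>. x D * ((\<Sum>E\<in>\<F>. (min_ind E D - N' E)\<^sup>2) - (\<Sum>E\<in>\<F>. (min_ind E D - N E)\<^sup>2)))
      = (\<Sum>E\<in>\<F>. 2 * (N E - N' E) * N E + ((N' E)\<^sup>2 - (N E)\<^sup>2))"
    unfolding sum_subtractf[symmetric] sq by (rule chain_solution_average[OF assms(1-4)])
  also have "\<dots> = (\<Sum>E\<in>\<F>. (N E - N' E)\<^sup>2)"
    by (intro sum.cong) (auto simp: power2_eq_square algebra_simps)
  also have "\<dots> \<ge> 0" by (simp add: sum_nonneg)
  finally show ?thesis using weighted_average_ge_0[OF assms(5,4)] by fastforce
qed

section \<open>Finitely additive probabilities on sets of events\<close>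

lemma finitely_additive_prob_Union:
  assumes "algebra X \<A>" "finitely_additive_prob X \<A> \<mu>" "finite \<P>" "\<P> \<subseteq> \<A>" "disjoint \<P>"
  shows "\<mu> (\<Union>\<P>) = sum \<mu> \<P>" "\<Union>\<P> \<in> \<A>"
proof -
  interpret algebra X \<A> by fact
  have add: "\<And>A B. A \<in> \<A> \<Longrightarrow> B \<in> \<A> \<Longrightarrow> A \<inter> B = {} \<Longrightarrow> \<mu> (A \<union> B) = \<mu> A + \<mu> B"
    using assms(2) by (auto simp: finitely_additive_prob_def additive_def)
  have "\<mu> (\<Union>\<P>) = sum \<mu> \<P> \<and> \<Union>\<P> \<in> \<A>"
    using assms(3-5)
  proof (induction \<P>)
    case empty
    then show ?case using add[of "{}" "{}"] by simp
  next
    case (insert A \<P>)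
    then have "A \<inter> \<Union>\<P> = {}" by (auto simp: disjoint_def)
    moreover have "disjoint \<P>" using insert.prems by (auto simp: disjoint_def)
    ultimately show ?case using insert add[of A "\<Union>\<P>"] by auto
  qed
  then show "\<mu> (\<Union>\<P>) = sum \<mu> \<P>" "\<Union>\<P> \<in> \<A>" by auto
qed

lemma finitely_additive_prob_mono:
  assumes "algebra X \<A>" "finitely_additive_prob X \<A> \<mu>" "A \<in> \<A>" "B \<in> \<A>" "A \<subseteq> B"
  shows "\<mu> A \<le> \<mu> B"
proof -
  interpret algebra X \<A> by fact
  have BA: "B - A \<in> \<A>" using assms by auto
  have "\<mu> (A \<union> (B - A)) = \<mu> A + \<mu> (B - A)"
    using assms(2,3) BA unfolding finitely_additive_prob_def additive_def by blast
  moreover have "\<mu> (B - A) \<ge> 0" using assms(2) BA by (auto simp: finitely_additive_prob_def)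
  moreover have "A \<union> (B - A) = B" using assms(5) by blast
  ultimately show ?thesis by simp
qed

text \<open>The lower sum of a partition is \<open>\<mu>\<close> of the union of its blocks inside
  \<open>S\<close>, and the upper sum is \<open>\<mu>\<close> of the union of its blocks meeting
  \<open>S\<close>. These bound \<open>\<mu> S\<close> from below and above, and the partition into
  \<open>S\<close> and its complement attains both bounds.\<close>

lemma has_charge_integral_indicator_iff:
  assumes alg: "algebra X \<A>" and prob: "finitely_additive_prob X \<A> \<mu>" and S: "S \<in> \<A>"
    and f: "\<And>x. x \<in> X \<Longrightarrow> f x = indicator S x"
  shows "has_charge_integral X \<A> \<mu> f I \<longleftrightarrow> I = \<mu> S"
proof -
  interpret algebra X \<A> by fact
  have f01: "f ` A \<subseteq> {0, 1}" if "A \<subseteq> X" for A using f that by (auto simp: indicator_def)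
  have INF: "(INF x\<in>A. f x) = (if A \<subseteq> S then 1 else 0)" if "A \<subseteq> X" "A \<noteq> {}" for A
  proof (cases "A \<subseteq> S")
    case True
    then have "f ` A = {1}" using that f by (force simp: indicator_def)
    then show ?thesis using True by simp
  next
    case False
    then have "0 \<in> f ` A" using that f by (force simp: indicator_def)
    then show ?thesis using False f01[OF that(1)] by (auto intro!: cInf_eq_minimum)
  qed
  have SUP: "(SUP x\<in>A. f x) = (if A \<inter> S \<noteq> {} then 1 else 0)" if "A \<subseteq> X" "A \<noteq> {}" for A
  proof (cases "A \<inter> S = {}")
    case True
    then have "f ` A = {0}" using that f by (force simp: indicator_def)
    then show ?thesis using True by simp
  next
    case False
    then have "1 \<in> f ` A" using that f by (force simp: indicator_def)
    then show ?thesis using False f01[OF that(1)] by (auto intro!: cSup_eq_maximum)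
  qed
  have filter: "(\<Sum>A\<in>\<P>. (if Q A then 1 else 0) * \<mu> A) = \<mu> (\<Union>{A \<in> \<P>. Q A})"
    "\<Union>{A \<in> \<P>. Q A} \<in> \<A>" if "\<P> \<in> algebra_partitions X \<A>" for \<P> Q
  proof -
    have \<P>: "finite \<P>" "\<P> \<subseteq> \<A>" "disjoint \<P>"
      using that by (auto simp: algebra_partitions_def partition_on_def)
    have sub: "finite {A \<in> \<P>. Q A}" "{A \<in> \<P>. Q A} \<subseteq> \<A>" "disjoint {A \<in> \<P>. Q A}"
      using \<P> by (auto simp: disjoint_def)
    show "\<Union>{A \<in> \<P>. Q A} \<in> \<A>" by (rule finitely_additive_prob_Union(2)[OF alg prob sub])
    have "(\<Sum>A\<in>\<P>. (if Q A then 1 else 0) * \<mu> A) = (\<Sum>A\<in>\<P>. if Q A then \<mu> A else 0)"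
      by (intro sum.cong) auto
    also have "\<dots> = sum \<mu> {A \<in> \<P>. Q A}" using \<P>(1) by (rule sum.inter_filter[symmetric])
    also have "\<dots> = \<mu> (\<Union>{A \<in> \<P>. Q A})"
      by (rule finitely_additive_prob_Union(1)[OF alg prob sub, symmetric])
    finally show "(\<Sum>A\<in>\<P>. (if Q A then 1 else 0) * \<mu> A) = \<mu> (\<Union>{A \<in> \<P>. Q A})" .
  qed
  have in_part: "A \<subseteq> X" "A \<noteq> {}" if "\<P> \<in> algebra_partitions X \<A>" "A \<in> \<P>" for \<P> A
    using that by (auto simp: algebra_partitions_def partition_on_def)
  have lower: "(\<Sum>A\<in>\<P>. (INF x\<in>A. f x) * \<mu> A) = \<mu> (\<Union>{A \<in> \<P>. A \<subseteq> S})"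
    if "\<P> \<in> algebra_partitions X \<A>" for \<P>
    unfolding filter(1)[OF that, symmetric]
    by (intro sum.cong refl arg_cong2[of _ _ _ _ "(*)"] INF in_part[OF that])
  have upper: "(\<Sum>A\<in>\<P>. (SUP x\<in>A. f x) * \<mu> A) = \<mu> (\<Union>{A \<in> \<P>. A \<inter> S \<noteq> {}})"
    if "\<P> \<in> algebra_partitions X \<A>" for \<P>
    unfolding filter(1)[OF that, symmetric]
    by (intro sum.cong refl arg_cong2[of _ _ _ _ "(*)"] SUP in_part[OF that])
  \<comment> \<open>The empty set is removed because \<open>S\<close> or its complement may be empty
    and a partition has no empty block.\<close>
  let ?P = "{S, X - S} - {{}}"
  have SX: "S \<subseteq> X" using S sets_into_space by blast
  have P: "?P \<in> algebra_partitions X \<A>"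
    using S SX by (auto simp: algebra_partitions_def partition_on_def disjoint_def)
  have "\<Union>{A \<in> ?P. A \<subseteq> S} = S" "\<Union>{A \<in> ?P. A \<inter> S \<noteq> {}} = S" by auto
  then have attained: "\<mu> S = (\<Sum>A\<in>?P. (INF x\<in>A. f x) * \<mu> A)" "\<mu> S = (\<Sum>A\<in>?P. (SUP x\<in>A. f x) * \<mu> A)"
    using lower[OF P] upper[OF P] by simp_all
  have "(SUP \<P> \<in> algebra_partitions X \<A>. \<Sum>A\<in>\<P>. (INF x\<in>A. f x) * \<mu> A) = \<mu> S"
  proof (rule cSup_eq_maximum)
    show "\<mu> S \<in> (\<lambda>\<P>. \<Sum>A\<in>\<P>. (INF x\<in>A. f x) * \<mu> A) ` algebra_partitions X \<A>"
      using attained(1) P by (rule image_eqI)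
    fix y assume "y \<in> (\<lambda>\<P>. \<Sum>A\<in>\<P>. (INF x\<in>A. f x) * \<mu> A) ` algebra_partitions X \<A>"
    then obtain \<P> where \<P>: "\<P> \<in> algebra_partitions X \<A>" "y = \<mu> (\<Union>{A \<in> \<P>. A \<subseteq> S})"
      using lower by auto
    show "y \<le> \<mu> S"
      unfolding \<P>(2) by (rule finitely_additive_prob_mono[OF alg prob filter(2)[OF \<P>(1)] S]) auto
  qed
  moreover have "(INF \<P> \<in> algebra_partitions X \<A>. \<Sum>A\<in>\<P>. (SUP x\<in>A. f x) * \<mu> A) = \<mu> S"
  proof (rule cInf_eq_minimum)
    show "\<mu> S \<in> (\<lambda>\<P>. \<Sum>A\<in>\<P>. (SUP x\<in>A. f x) * \<mu> A) ` algebra_partitions X \<A>"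
      using attained(2) P by (rule image_eqI)
    fix y assume "y \<in> (\<lambda>\<P>. \<Sum>A\<in>\<P>. (SUP x\<in>A. f x) * \<mu> A) ` algebra_partitions X \<A>"
    then obtain \<P> where \<P>: "\<P> \<in> algebra_partitions X \<A>" "y = \<mu> (\<Union>{A \<in> \<P>. A \<inter> S \<noteq> {}})"
      using upper by auto
    have "\<Union>\<P> = X" using \<P>(1) by (auto simp: algebra_partitions_def partition_on_def)
    then have "S \<subseteq> \<Union>{A \<in> \<P>. A \<inter> S \<noteq> {}}" using SX by blast
    then show "\<mu> S \<le> y"
      unfolding \<P>(2) by (rule finitely_additive_prob_mono[OF alg prob S filter(2)[OF \<P>(1)]])
  qed
  moreover have "bounded (f ` X)" using f01[of X] by (meson bounded_subset finite_imp_bounded finite.intros subset_refl)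
  ultimately show ?thesis unfolding has_charge_integral_def by auto
qed

section \<open>Charges that represent a minitive measure\<close>

lemma algebra_subevents_algebra: "algebra (nonempty_events \<Omega> \<E>) (subevents_algebra \<Omega> \<E>)"
  unfolding subevents_algebra_def by (rule algebra_gen_algebra) (auto simp: subevents_def)

lemma subevents_in_subevents_algebra:
  assumes "A \<in> gen_algebra \<Omega> \<E>"
  shows "subevents \<Omega> \<E> A \<in> subevents_algebra \<Omega> \<E>"
proof (cases "A = {}")
  case True
  interpret algebra "nonempty_events \<Omega> \<E>" "subevents_algebra \<Omega> \<E>" by (rule algebra_subevents_algebra)
  have "subevents \<Omega> \<E> A = {}" using True by (auto simp: subevents_def nonempty_events_def)
  then show ?thesis by simp
next
  case False
  then have "A \<in> nonempty_events \<Omega> \<E>" using assms by (simp add: nonempty_events_def)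
  then show ?thesis unfolding subevents_algebra_def using gen_algebra_superset by blast
qed

text \<open>On nonempty events \<open>min_ind E\<close> is the indicator of
  \<open>subevents \<Omega> \<E> E\<close>. The integral in condition 2 thus reduces to one value of
  \<open>\<mu>\<close>.\<close>

lemma has_charge_integral_min_ind_iff:
  assumes "E \<in> \<E>" "finitely_additive_prob (nonempty_events \<Omega> \<E>) (subevents_algebra \<Omega> \<E>) \<mu>"
  shows "has_charge_integral (nonempty_events \<Omega> \<E>) (subevents_algebra \<Omega> \<E>) \<mu> (\<lambda>B. min_ind E B) I
    \<longleftrightarrow> I = \<mu> (subevents \<Omega> \<E> E)"
proof (rule has_charge_integral_indicator_iff[OF algebra_subevents_algebra assms(2)])
  show "subevents \<Omega> \<E> E \<in> subevents_algebra \<Omega> \<E>"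
    using assms(1) gen_algebra_superset by (blast intro: subevents_in_subevents_algebra)
  show "min_ind E B = indicator (subevents \<Omega> \<E> E) B" if "B \<in> nonempty_events \<Omega> \<E>" for B
  proof -
    have "B \<noteq> {}" using that by (simp add: nonempty_events_def)
    then show ?thesis using that by (simp add: min_ind_eq subevents_def)
  qed
qed

lemma minitive_necessity_charge:
  assumes "\<E> \<subseteq> Pow \<Omega>"
    and \<nu>: "finitely_minitive_necessity \<Omega> (gen_algebra \<Omega> \<E>) \<nu>"
  obtains \<mu> where "finitely_additive_prob (nonempty_events \<Omega> \<E>) (subevents_algebra \<Omega> \<E>) \<mu>"
    and "\<And>A. A \<in> gen_algebra \<Omega> \<E> \<Longrightarrow> \<mu> (subevents \<Omega> \<E> A) = \<nu> A"
proof -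
  let ?A = "gen_algebra \<Omega> \<E>" and ?X = "nonempty_events \<Omega> \<E>" and ?AA = "subevents_algebra \<Omega> \<E>"
  interpret algebra \<Omega> ?A by (rule algebra_gen_algebra[OF assms(1)])
  interpret AA: algebra ?X ?AA by (rule algebra_subevents_algebra)
  have \<nu>01: "\<And>A. A \<in> ?A \<Longrightarrow> 0 \<le> \<nu> A \<and> \<nu> A \<le> 1" and \<nu>0: "\<nu> {} = 0" and \<nu>1: "\<nu> \<Omega> = 1"
    and \<nu>_Int: "\<And>A B. A \<in> ?A \<Longrightarrow> B \<in> ?A \<Longrightarrow> \<nu> (A \<inter> B) = min (\<nu> A) (\<nu> B)"
    using \<nu> by (auto simp: finitely_minitive_necessity_def)
  \<comment> \<open>By minitivity the events of necessity at least \<open>t\<close> are closed under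
    intersection. \<open>ev t S\<close> says that all of them below some member lie in
    \<open>S\<close>.\<close>
  define ev where "ev t S \<longleftrightarrow> (\<exists>A\<in>?A. t \<le> \<nu> A \<and> (\<forall>B\<in>?A. t \<le> \<nu> B \<longrightarrow> B \<subseteq> A \<longrightarrow> B \<in> S))" for t S
  have ev_mono: "ev t T" if "ev t S" "S \<subseteq> T" for t S T
    using that unfolding ev_def by blast
  have ev_Int: "ev t (S \<inter> T)" if ST: "ev t S" "ev t T" for t S T
  proof -
    obtain A B where "A \<in> ?A" "t \<le> \<nu> A" "\<forall>C\<in>?A. t \<le> \<nu> C \<longrightarrow> C \<subseteq> A \<longrightarrow> C \<in> S"
      "B \<in> ?A" "t \<le> \<nu> B" "\<forall>C\<in>?A. t \<le> \<nu> C \<longrightarrow> C \<subseteq> B \<longrightarrow> C \<in> T"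
      using ST unfolding ev_def by blast
    then show ?thesis unfolding ev_def by (intro bexI[of _ "A \<inter> B"]) (auto simp: \<nu>_Int)
  qed
  have ev_not_empty: "\<not> ev t {}" for t unfolding ev_def by blast
  have ev_disj: "\<not> (ev t S \<and> ev t T)" if "S \<inter> T = {}" for t S T
    using ev_Int[of t S T] ev_not_empty that by auto
  have ev_X: "ev t ?X" if "t \<in> {0<..1}" for t
    using that \<nu>0 \<nu>1 unfolding ev_def nonempty_events_def by (intro bexI[of _ \<Omega>]) auto
  have ev_sub: "ev t (subevents \<Omega> \<E> A) \<longleftrightarrow> t \<le> \<nu> A" if A: "A \<in> ?A" and t: "t \<in> {0<..1}" for t A
  proof
    assume "ev t (subevents \<Omega> \<E> A)"
    then obtain B where "B \<in> ?A" "t \<le> \<nu> B" "B \<subseteq> A" unfolding ev_def subevents_def by auto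
    then show "t \<le> \<nu> A" using finitely_minitive_necessity_mono[OF \<nu>, of B A] A by auto
  next
    assume "t \<le> \<nu> A"
    then show "ev t (subevents \<Omega> \<E> A)"
      using A t \<nu>0 unfolding ev_def subevents_def nonempty_events_def by (intro bexI[of _ A]) auto
  qed
  \<comment> \<open>Only levels \<open>t > 0\<close> count: at level 0 the empty event would qualify
    too, and \<open>ev 0\<close> would fail for the whole space
    \<open>nonempty_events \<Omega> \<E>\<close>.\<close>
  define L where "L S = {t \<in> {0<..1::real}. ev t S}" for S
  \<comment> \<open>The sets that are decided at every level and whose accepting levels form a Borel
    set. Once \<open>M\<close> is an algebra containing the generators, it contains all of
    \<open>subevents_algebra \<Omega> \<E>\<close>.\<close>
  define M where "M = {S. S \<subseteq> ?X \<and> (\<forall>t\<in>{0<..1}. ev t S \<or> ev t (?X - S)) \<and> L S \<in> sets lborel}"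
  have L_Diff: "L (?X - S) = {0<..1} - L S" if "S \<in> M" for S
    using that ev_disj[of S "?X - S"] unfolding L_def M_def by auto
  have L_Un: "L (S \<union> T) = L S \<union> L T" if "S \<in> M" "T \<in> M" for S T
  proof
    show "L S \<union> L T \<subseteq> L (S \<union> T)" unfolding L_def by (auto intro: ev_mono)
    \<comment> \<open>This inclusion needs decidedness: if neither set held eventually, both
      complements would, hence also their intersection, which is disjoint from the union.\<close>
    show "L (S \<union> T) \<subseteq> L S \<union> L T"
    proof
      fix t assume t: "t \<in> L (S \<union> T)"
      show "t \<in> L S \<union> L T"
      proof (rule ccontr)
        assume "t \<notin> L S \<union> L T"
        then have "ev t (?X - S)" "ev t (?X - T)" using t that unfolding L_def M_def by auto
        then have "ev t ((?X - S) \<inter> (?X - T))" by (rule ev_Int)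
        then show False using ev_disj[of "(?X - S) \<inter> (?X - T)" "S \<union> T" t] t unfolding L_def by blast
      qed
    qed
  qed
  have "algebra ?X M"
    unfolding algebra_iff_Un
  proof (intro conjI ballI)
    show "M \<subseteq> Pow ?X" by (auto simp: M_def)
    show "{} \<in> M" using ev_X by (auto simp: M_def L_def ev_not_empty)
    show "?X - S \<in> M" if "S \<in> M" for S
    proof -
      have "L (?X - S) \<in> sets lborel" unfolding L_Diff[OF that] using that by (auto simp: M_def)
      moreover have "?X - (?X - S) = S" using that by (auto simp: M_def)
      ultimately show ?thesis using that unfolding M_def by auto
    qed
    show "S \<union> T \<in> M" if ST: "S \<in> M" "T \<in> M" for S T
    proof -
      have "L (S \<union> T) \<in> sets lborel" unfolding L_Un[OF ST] using ST by (auto simp: M_def)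
      moreover have "ev t (S \<union> T) \<or> ev t (?X - (S \<union> T))" if t: "t \<in> {0<..1}" for t
      proof (cases "ev t S \<or> ev t T")
        case True
        then show ?thesis by (auto intro: ev_mono)
      next
        case False
        then have "ev t ((?X - S) \<inter> (?X - T))" using ST t by (intro ev_Int) (auto simp: M_def)
        then show ?thesis by (simp add: Diff_Un)
      qed
      ultimately show ?thesis using ST unfolding M_def by auto
    qed
  qed
  have L_sub: "L (subevents \<Omega> \<E> A) = {0<..\<nu> A}" if "A \<in> ?A" for A
    using that \<nu>01[OF that] by (auto simp: L_def ev_sub)
  have "subevents \<Omega> \<E> A \<in> M" if A: "A \<in> ?A" for A
  proof -
    \<comment> \<open>At a level above \<open>\<nu> A\<close> no event of the filter is contained in
      \<open>A\<close>, so the complement holds from \<open>\<Omega>\<close> downwards.\<close>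
    have "ev t (?X - subevents \<Omega> \<E> A)" if t: "t \<in> {0<..1}" and "\<not> t \<le> \<nu> A" for t
      unfolding ev_def
    proof (intro bexI[of _ \<Omega>] conjI ballI impI)
      fix B assume B: "B \<in> ?A" "t \<le> \<nu> B"
      have "\<not> B \<subseteq> A"
        using finitely_minitive_necessity_mono[OF \<nu> B(1) A] B(2) \<open>\<not> t \<le> \<nu> A\<close> by auto
      then show "B \<in> ?X - subevents \<Omega> \<E> A"
        using B by (auto simp: nonempty_events_def subevents_def)
    qed (use t \<nu>1 in auto)
    then show ?thesis
      using A by (auto simp: M_def L_sub ev_sub) (auto simp: subevents_def)
  qed
  then have AA_M: "?AA \<subseteq> M"
    unfolding subevents_algebra_def using \<open>algebra ?X M\<close>
    by (intro gen_algebra_least) (auto simp: nonempty_events_def)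
  \<comment> \<open>Averaging the two-valued charges over uniformly distributed levels amounts to
    taking the length of the set of accepting levels. For \<open>subevents \<Omega> \<E> A\<close>
    this set is the interval \<open>{0<..\<nu> A}\<close>.\<close>
  define \<mu> where "\<mu> S = measure lborel (L S)" for S
  have L_fin: "L S \<in> fmeasurable lborel" if "S \<in> ?AA" for S
  proof (rule fmeasurableI2)
    show "{0<..1::real} \<in> fmeasurable lborel" by (simp add: fmeasurable_def)
    show "L S \<in> sets lborel" using that AA_M by (auto simp: M_def)
  qed (auto simp: L_def)
  show ?thesis
  proof (rule that[of \<mu>])
    show "\<mu> (subevents \<Omega> \<E> A) = \<nu> A" if "A \<in> ?A" for A
      using \<nu>01[OF that] by (simp add: \<mu>_def L_sub[OF that])
    have X: "L ?X = {0<..1}" using ev_X by (auto simp: L_def)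
    have "\<mu> S \<le> 1" if S: "S \<in> ?AA" for S
    proof -
      have "measure lborel (L S) \<le> measure lborel (L ?X)"
        using L_fin[OF AA.top] L_fin[OF S] ev_mono[of _ S ?X] AA.sets_into_space[OF S]
        by (intro measure_mono_fmeasurable) (auto simp: L_def)
      then show ?thesis by (simp add: \<mu>_def X)
    qed
    moreover have "additive ?AA \<mu>"
      unfolding additive_def
    proof (intro ballI impI)
      fix S T assume ST: "S \<in> ?AA" "T \<in> ?AA" "S \<inter> T = {}"
      then have "L (S \<union> T) = L S \<union> L T" using AA_M by (intro L_Un) auto
      moreover have "L S \<inter> L T = {}" using ev_disj[OF ST(3)] by (auto simp: L_def)
      ultimately show "\<mu> (S \<union> T) = \<mu> S + \<mu> T"
        unfolding \<mu>_def using L_fin[OF ST(1)] L_fin[OF ST(2)]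
        by (simp add: measure_Un3)
    qed
    ultimately show "finitely_additive_prob ?X ?AA \<mu>"
      unfolding finitely_additive_prob_def by (auto simp: \<mu>_def X)
  qed
qed

lemma coherent1_iff_coherent2:
  assumes "\<E> \<subseteq> Pow \<Omega>"
  shows "coherent1 \<Omega> \<E> N \<longleftrightarrow> coherent2 \<Omega> \<E> N"
proof
  assume "coherent1 \<Omega> \<E> N"
  then obtain \<nu> where \<nu>: "finitely_minitive_necessity \<Omega> (gen_algebra \<Omega> \<E>) \<nu>" "\<forall>E\<in>\<E>. N E = \<nu> E"
    by (auto simp: coherent1_def)
  obtain \<mu> where \<mu>: "finitely_additive_prob (nonempty_events \<Omega> \<E>) (subevents_algebra \<Omega> \<E>) \<mu>"
    "\<And>A. A \<in> gen_algebra \<Omega> \<E> \<Longrightarrow> \<mu> (subevents \<Omega> \<E> A) = \<nu> A"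
    using minitive_necessity_charge[OF assms \<nu>(1)] by blast
  interpret algebra \<Omega> "gen_algebra \<Omega> \<E>" by (rule algebra_gen_algebra[OF assms])
  have "finitely_minitive_necessity \<Omega> (gen_algebra \<Omega> \<E>) (\<lambda>A. \<mu> (subevents \<Omega> \<E> A))"
    using \<nu>(1) unfolding finitely_minitive_necessity_def by (auto simp: \<mu>(2) Int)
  moreover have "N E = \<mu> (subevents \<Omega> \<E> E)" if "E \<in> \<E>" for E
    using that \<nu>(2) \<mu>(2)[of E] gen_algebra_superset[of \<E> \<Omega>] by auto
  ultimately show "coherent2 \<Omega> \<E> N"
    unfolding coherent2_def using \<mu>(1) by (auto simp: has_charge_integral_min_ind_iff)
next
  assume "coherent2 \<Omega> \<E> N"
  then show "coherent1 \<Omega> \<E> N"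
    unfolding coherent1_def coherent2_def by (auto simp: has_charge_integral_min_ind_iff)
qed

section \<open>Equivalence of the five coherence conditions\<close>

theorem corollary2:
  fixes \<Omega> :: "'a set" and \<E> :: "'a set set" and N :: "'a set \<Rightarrow> real"
  assumes "\<Omega> \<noteq> {}"
    and "\<E> \<subseteq> Pow \<Omega>" and "\<E> \<noteq> {}"
    and "N \<in> \<E> \<rightarrow> {0..1}"
  shows "(coherent1 \<Omega> \<E> N \<longleftrightarrow> coherent2 \<Omega> \<E> N) \<and>
         (coherent2 \<Omega> \<E> N \<longleftrightarrow> coherent3 \<Omega> \<E> N) \<and>
         (coherent3 \<Omega> \<E> N \<longleftrightarrow> coherent4 \<Omega> \<E> N) \<and>
         (coherent4 \<Omega> \<E> N \<longleftrightarrow> coherent5 \<Omega> \<E> N)"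
proof -
  note props = event_chains_props[OF assms(1)]
  have N: "N \<in> \<F> \<rightarrow> {0..1}" "\<F> \<subseteq> Pow \<Omega>" if "\<F> \<subseteq> \<E>" for \<F> using that assms(2,4) by auto
  have 34: "coherent4 \<Omega> \<E> N" if c: "coherent3 \<Omega> \<E> N"
    unfolding coherent4_def
  proof (intro allI impI)
    fix \<F> assume F: "finite \<F> \<and> \<F> \<noteq> {} \<and> \<F> \<subseteq> \<E>"
    obtain \<D> x where D: "\<D> \<in> event_chains \<Omega> \<F>"
      and x: "\<forall>E\<in>\<F>. (\<Sum>D\<in>\<D>. min_ind E D * x D) = N E" "(\<Sum>D\<in>\<D>. x D) = 1" "\<forall>D\<in>\<D>. x D \<ge> 0"
      using mp[OF spec[OF c[unfolded coherent3_def]] F] by (elim bexE exE conjE)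
    have fin: "finite \<F>" "\<F> \<subseteq> Pow \<Omega>" using F N by auto
    show "\<exists>\<D>\<in>event_chains \<Omega> \<F>. \<forall>c. (MAX D\<in>\<D>. \<Sum>E\<in>\<F>. c E * (min_ind E D - N E)) \<ge> 0"
      using chain_solution_imp_betting[OF props(1,2)[OF fin(2,1) D] fin(1) x] D by blast
  qed
  have 35: "coherent5 \<Omega> \<E> N" if c: "coherent3 \<Omega> \<E> N"
    unfolding coherent5_def
  proof (intro allI impI)
    fix \<F> assume F: "finite \<F> \<and> \<F> \<noteq> {} \<and> \<F> \<subseteq> \<E>"
    obtain \<D> x where D: "\<D> \<in> event_chains \<Omega> \<F>"
      and x: "\<forall>E\<in>\<F>. (\<Sum>D\<in>\<D>. min_ind E D * x D) = N E" "(\<Sum>D\<in>\<D>. x D) = 1" "\<forall>D\<in>\<D>. x D \<ge> 0"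
      using mp[OF spec[OF c[unfolded coherent3_def]] F] by (elim bexE exE conjE)
    have fin: "finite \<F>" "\<F> \<subseteq> Pow \<Omega>" using F N by auto
    show "\<exists>\<D>\<in>event_chains \<Omega> \<F>.
          \<not> (\<exists>N'. N' \<in> \<F> \<rightarrow> {0..1} \<and> (\<exists>E\<in>\<F>. N' E \<noteq> N E) \<and>
               (\<forall>D\<in>\<D>. (\<Sum>E\<in>\<F>. (min_ind E D - N' E)\<^sup>2) < (\<Sum>E\<in>\<F>. (min_ind E D - N E)\<^sup>2)))"
      using chain_solution_imp_penalty[OF props(1)[OF fin(2,1) D] fin(1) x] D
      by (meson not_le)
  qed
  have 41: "coherent1 \<Omega> \<E> N" if c: "coherent4 \<Omega> \<E> N"
  proof (rule coherent1_if_chain_monotone[OF assms(1,2,4)])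
    fix \<F> assume F: "finite \<F>" "\<F> \<noteq> {}" "\<F> \<subseteq> \<E>"
    then have F': "finite \<F> \<and> \<F> \<noteq> {} \<and> \<F> \<subseteq> \<E>" by simp
    obtain \<D> where D: "\<D> \<in> event_chains \<Omega> \<F>"
      and max: "\<And>c. (MAX D\<in>\<D>. \<Sum>E\<in>\<F>. c E * (min_ind E D - N E)) \<ge> 0"
      using mp[OF spec[OF c[unfolded coherent4_def]] F'] by (elim bexE) blast
    show "\<exists>\<D>\<in>event_chains \<Omega> \<F>. chain_monotone \<D> \<F> N"
      using betting_imp_chain_monotone[OF F(1) props(1-3)[OF N(2)[OF F(3)] F(1) D] N(1)[OF F(3)] max] D
      by blast
  qed
  have 51: "coherent1 \<Omega> \<E> N" if c: "coherent5 \<Omega> \<E> N"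
  proof (rule coherent1_if_chain_monotone[OF assms(1,2,4)])
    fix \<F> assume F: "finite \<F>" "\<F> \<noteq> {}" "\<F> \<subseteq> \<E>"
    then have F': "finite \<F> \<and> \<F> \<noteq> {} \<and> \<F> \<subseteq> \<E>" by simp
    obtain \<D> where D: "\<D> \<in> event_chains \<Omega> \<F>"
      and undom: "\<And>N'. N' \<in> \<F> \<rightarrow> {0..1} \<Longrightarrow> \<exists>E\<in>\<F>. N' E \<noteq> N E \<Longrightarrow>
        \<exists>D\<in>\<D>. (\<Sum>E\<in>\<F>. (min_ind E D - N E)\<^sup>2) \<le> (\<Sum>E\<in>\<F>. (min_ind E D - N' E)\<^sup>2)"
      using mp[OF spec[OF c[unfolded coherent5_def]] F'] by (elim bexE) (meson not_le)
    show "\<exists>\<D>\<in>event_chains \<Omega> \<F>. chain_monotone \<D> \<F> N"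
      using penalty_imp_chain_monotone[OF F(1) props(3)[OF N(2)[OF F(3)] F(1) D] N(1)[OF F(3)] undom] D
      by blast
  qed
  \<comment> \<open>Conditions 1, 3, 4 and conditions 1, 3, 5 each form a cycle of implications;
    condition 2 is tied to condition 1 directly.\<close>
  show ?thesis
    using coherent1_iff_coherent2[OF assms(2)] coherent1_imp_coherent3[OF assms(1,2)] 34 35 41 51
    by blast
qed

end
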